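(* The local truncation error $TE^n$ of the Leapfrog scheme ($k=2$) $$ \frac{i}{2\tau}(u^{n+1}-u^{n-1})=-\frac14\bigl(\Delta u^{n+1}+2\Delta u^n+\Delta u^{n-1}\bigr)+\frac{\lambda}{8}\Bigl(\Bigl|\frac{u^n+u^{n-1}}{2}\Bigr|^2+\Bigl|\frac{u^{n+1}+u^n}{2}\Bigr|^2\Bigr)\bigl(u^{n+1}+2u^n+u^{n-1}\bigr) $$ is $O(\tau^2)$.
   Context: The scheme approximates the cubic nonlinear Schrödinger equation $iu_t=-\Delta u+\lambda|u|^2u$ in $\mathcal{D}\times(0,T)$, where $\mathcal{D}\subset\mathbf{R}^d$ ($d=1,2,3$) is a bounded domain, $T>0$, $\lambda=\pm1$, $i=\sqrt{-1}$ and $u$ is complex-valued. Here $\tau>0$ is the time step, $t_n=n\tau$ is a uniform mesh of $[0,T]$, and $k$ is the number of steps of the scheme. The local truncation error is defined by $$ TE^n=\frac{i}{2\tau}\bigl(u(t_{n+1})-u(t_{n-1})\bigr)+\frac14\Delta\bigl(u(t_{n+1})+2u(t_n)+u(t_{n-1})\bigr) $$ $$ \qquad-\frac{\lambda}{8}\Bigl[\Bigl|\frac{u(t_n)+u(t_{n-1})}{2}\Bigr|^2+\Bigl|\frac{u(t_{n+1})+u(t_n)}{2}\Bigr|^2\Bigr]\bigl(u(t_{n+1})+2u(t_n)+u(t_{n-1})\bigr), $$ where $u(t)$ is the true solution of the equation, $iu_t(t)+\Delta u(t)-\lambda|u(t)|^2u(t)=0$, with the dependence on $x$ suppressed.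
   Formalization: The true solution is assumed C² in space, solving the equation classically, with Δu continuous in time on [0,T], and C³ in time on [0,T] with u and its time derivatives up to order 3 bounded on [0,T]×D; O(τ²) is read as uniform in n and x. *)

theory Defs
  imports "HOL-Analysis.Analysis"
begin

section \<open>Differentiability in space\<close>

text \<open>
  Only the values of \<open>f\<close> near \<open>x\<close> matter below, so on an open set \<open>D\<close> everything is
  independent of how a function on \<open>D\<close> is extended to the whole space.
\<close>

definition partial :: "'a::euclidean_space \<Rightarrow> ('a \<Rightarrow> complex) \<Rightarrow> 'a \<Rightarrow> complex" where
  "partial b f x = vector_derivative (\<lambda>s::real. f (x + s *\<^sub>R b)) (at 0)"

definition laplacian :: "('a::euclidean_space \<Rightarrow> complex) \<Rightarrow> 'a \<Rightarrow> complex" where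
  "laplacian f x = (\<Sum>b\<in>Basis. partial b (partial b f) x)"

fun Ck_on :: "nat \<Rightarrow> 'a::euclidean_space set \<Rightarrow> ('a \<Rightarrow> complex) \<Rightarrow> bool" where
  "Ck_on 0 D f \<longleftrightarrow> continuous_on D f"
| "Ck_on (Suc k) D f \<longleftrightarrow> continuous_on D f \<and>
     (\<forall>b\<in>Basis. (\<forall>x\<in>D. (\<lambda>s::real. f (x + s *\<^sub>R b)) differentiable (at 0)) \<and>
        Ck_on k D (partial b f))"


section \<open>Regularity in time\<close>

text \<open>
  \<open>u\<close> is \<open>k\<close> times continuously differentiable in time on the closed interval \<open>[0,T]\<close>
  (one-sided at the end points), with all time derivatives up to order \<open>k\<close> bounded uniformly
  in \<open>x \<in> D\<close>; \<open>w j\<close> is the \<open>j\<close>-th time derivative of \<open>u\<close>.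
\<close>

definition time_Ck_bounded ::
    "nat \<Rightarrow> real \<Rightarrow> 'a set \<Rightarrow> (real \<Rightarrow> 'a \<Rightarrow> complex) \<Rightarrow> bool" where
  "time_Ck_bounded k T D u \<longleftrightarrow>
     (\<exists>w :: nat \<Rightarrow> real \<Rightarrow> 'a \<Rightarrow> complex. w 0 = u \<and>
        (\<forall>j<k. \<forall>x\<in>D. \<forall>t\<in>{0..T}.
           ((\<lambda>s. w j s x) has_vector_derivative w (Suc j) t x) (at t within {0..T})) \<and>
        (\<forall>j\<le>k. \<forall>x\<in>D. continuous_on {0..T} (\<lambda>t. w j t x)) \<and>
        (\<forall>j\<le>k. bounded ((\<lambda>(t, x). w j t x) ` ({0..T} \<times> D))))"


section \<open>The equation\<close>

definition NLS_solution ::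
    "real \<Rightarrow> 'a::euclidean_space set \<Rightarrow> real \<Rightarrow> (real \<Rightarrow> 'a \<Rightarrow> complex) \<Rightarrow> bool" where
  "NLS_solution T D lam u \<longleftrightarrow>
     (\<forall>t\<in>{0..T}. Ck_on 2 D (u t)) \<and>
     (\<forall>x\<in>D. continuous_on {0..T} (\<lambda>t. laplacian (u t) x)) \<and>
     (\<forall>t\<in>{0<..<T}. \<forall>x\<in>D.
        (\<lambda>s. u s x) differentiable (at t) \<and>
        \<i> * vector_derivative (\<lambda>s. u s x) (at t) + laplacian (u t) x
          - of_real lam * of_real ((cmod (u t x))\<^sup>2) * u t x = 0)"


section \<open>The scheme\<close>

text \<open>
  Left-hand side minus right-hand side of the scheme at step \<open>n\<close>, for a sequence \<open>U\<close> of
  functions in place of the \<open>u\<^sup>n\<close>, with the Laplacian applied to the sum of the three terms (by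
  linearity the same as the sum of the Laplacians for functions of class C2). Since \<open>n - 1\<close>
  is truncated subtraction on the naturals, this is meaningful for \<open>n \<ge> 1\<close> only.
\<close>

definition leapfrog_residual ::
    "real \<Rightarrow> real \<Rightarrow> (nat \<Rightarrow> 'a::euclidean_space \<Rightarrow> complex) \<Rightarrow> nat \<Rightarrow> 'a \<Rightarrow> complex" where
  "leapfrog_residual lam \<tau> U n x =
     \<i> / (2 * of_real \<tau>) * (U (n + 1) x - U (n - 1) x)
     + 1 / 4 * laplacian (\<lambda>y. U (n + 1) y + 2 * U n y + U (n - 1) y) x
     - of_real lam / 8 *
         (of_real ((cmod ((U n x + U (n - 1) x) / 2))\<^sup>2)
           + of_real ((cmod ((U (n + 1) x + U n x) / 2))\<^sup>2))
         * (U (n + 1) x + 2 * U n x + U (n - 1) x)"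

definition TE ::
    "real \<Rightarrow> real \<Rightarrow> (real \<Rightarrow> 'a::euclidean_space \<Rightarrow> complex) \<Rightarrow> nat \<Rightarrow> 'a \<Rightarrow> complex" where
  "TE lam \<tau> u n x = leapfrog_residual lam \<tau> (\<lambda>m. u (real m * \<tau>)) n x"

end

theory Submission
  imports Defs
begin

text \<open>
  Fix a point \<open>x\<close> and put \<open>t = n \<tau>\<close>, \<open>a = u(t + \<tau>)\<close>, \<open>b = u(t)\<close>, \<open>c = u(t - \<tau>)\<close>.
  The scheme evaluates both sides of the equation with averages symmetric about \<open>t\<close>, and the
  equation itself removes all space derivatives from the truncation error: replacing
  \<open>\<Delta>u\<close> by \<open>\<lambda>|u|\<^sup>2u - iu\<^sub>t\<close> at the three time levels gives
  \<open>TE = i E\<^sub>1 + \<lambda> E\<^sub>2\<close>, where \<open>E\<^sub>1\<close> is the central difference quotient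
  \<open>(a - c) / 2\<tau>\<close> minus the weighted mean (weights 1/4, 1/2, 1/4) of \<open>u\<^sub>t\<close>, and \<open>E\<^sub>2\<close> is
  the same weighted mean of \<open>|u|\<^sup>2u\<close> minus the cubic expression of the scheme. Hence the
  size of \<open>TE\<close> is governed by derivatives in time alone.

  For \<open>E\<^sub>1\<close>, Taylor expansion about \<open>t\<close> makes all terms below order \<open>\<tau>\<^sup>2\<close> cancel by symmetry
  (\<open>leapfrog_linear_defect\<close>). For \<open>E\<^sub>2\<close>, both cubic expressions are polynomials in the
  increments \<open>a - b\<close> and \<open>c - b\<close>, which are \<open>O(\<tau>)\<close>, and they agree in degrees 0 and 1
  (\<open>cubic_average_defect\<close>). If \<open>M\<close> bounds \<open>u\<close> and its first three time derivatives, the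
  constant obtained is \<open>3/2 M + 7/2 M\<^sup>3\<close>, independent of \<open>x\<close>, \<open>n\<close> and \<open>\<tau>\<close>.

  Two points need care. At the first and last time levels the equation is available only as a
  limit, since it is posed on the open time interval (\<open>NLS_at_closed_interval\<close>). And splitting
  the Laplacian over the three levels uses differentiability, because \<open>partial\<close> is a total
  function and linear only on functions that have the derivative (\<open>laplacian_leapfrog_sum\<close>).
\<close>

section \<open>Taylor expansion of vector-valued functions of time\<close>

text \<open>
  Integrating a bound by the mean value inequality, on the segment from \<open>t\<close> to \<open>s\<close>, raises the
  order of vanishing at \<open>t\<close> by one. Replacing the bound on \<open>f'\<close> by its value at the far end of the segment
  costs the factor \<open>1 / (k + 1)\<close> of an exact integration, but treats \<open>s\<close> on either side of
  \<open>t\<close> alike.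
\<close>

lemma vanishing_order_Suc:
  fixes f :: "real \<Rightarrow> 'a::real_normed_vector"
  assumes S: "convex S" "t \<in> S" "s \<in> S"
    and df: "\<And>r. r \<in> S \<Longrightarrow> (f has_vector_derivative f' r) (at r within S)"
    and f0: "f t = 0"
    and bd: "\<And>r. r \<in> S \<Longrightarrow> norm (f' r) \<le> K * \<bar>r - t\<bar> ^ k"
    and K: "0 \<le> K"
  shows "norm (f s) \<le> K * \<bar>s - t\<bar> ^ Suc k"
proof -
  let ?I = "closed_segment t s"
  have I: "?I \<subseteq> S"
    using S by (simp add: closed_segment_subset)
  have "norm (f s - f t) \<le> (K * \<bar>s - t\<bar> ^ k) * norm (s - t)"
  proof (rule differentiable_bound[of ?I])
    fix r assume r: "r \<in> ?I"
    show "(f has_derivative (\<lambda>h. h *\<^sub>R f' r)) (at r within ?I)"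
      using df[of r] r I has_vector_derivative_within_subset
      unfolding has_vector_derivative_def by blast
    have "\<bar>r - t\<bar> \<le> \<bar>s - t\<bar>"
      using r by (auto simp: closed_segment_eq_real_ivl split: if_splits)
    then have "K * \<bar>r - t\<bar> ^ k \<le> K * \<bar>s - t\<bar> ^ k"
      using K by (intro mult_left_mono power_mono) auto
    then have "norm (f' r) \<le> K * \<bar>s - t\<bar> ^ k"
      using bd[of r] r I by force
    then show "onorm (\<lambda>h. h *\<^sub>R f' r) \<le> K * \<bar>s - t\<bar> ^ k"
      by (intro onorm_le) (simp add: mult.commute mult_left_mono)
  qed auto
  then show ?thesis
    using f0 by (simp add: mult_ac)
qed

text \<open>
  Here \<open>w j\<close> is the \<open>j\<close>-th derivative of \<open>w 0\<close>. The derivative of the Taylor remainder of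
  \<open>w 0\<close> is the remainder, one order lower, of \<open>w 1\<close>; so the bound follows by induction on the
  order, shifting the sequence \<open>w\<close>. Expansions backwards in time and one-sided derivatives at
  the ends of \<open>S\<close> are covered.
\<close>

lemma Taylor_remainder_bound:
  fixes w :: "nat \<Rightarrow> real \<Rightarrow> 'a::real_normed_vector"
  assumes S: "convex S" "t \<in> S" "s \<in> S"
    and dw: "\<And>j r. j < n \<Longrightarrow> r \<in> S \<Longrightarrow>
               (w j has_vector_derivative w (Suc j) r) (at r within S)"
    and bd: "\<And>r. r \<in> S \<Longrightarrow> norm (w n r) \<le> K"
  shows "norm (w 0 s - (\<Sum>j<n. ((s - t) ^ j / fact j) *\<^sub>R w j t)) \<le> K * \<bar>s - t\<bar> ^ n"
  using S(3) dw bd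
proof (induction n arbitrary: w s)
  case 0
  then show ?case by simp
next
  case (Suc n)
  define f where "f r = w 0 r - (\<Sum>j<Suc n. ((r - t) ^ j / fact j) *\<^sub>R w j t)" for r
  define f' where "f' r = w 1 r - (\<Sum>j<n. ((r - t) ^ j / fact j) *\<^sub>R w (Suc j) t)" for r
  have f_alt: "f r = w 0 r - (w 0 t + (\<Sum>j<n. ((r - t) ^ Suc j / fact (Suc j)) *\<^sub>R w (Suc j) t))"
    for r
    unfolding f_def by (subst sum.lessThan_Suc_shift) simp
  have "norm (f s) \<le> K * \<bar>s - t\<bar> ^ Suc n"
  proof (rule vanishing_order_Suc[OF S(1,2) Suc.prems(1)])
    fix r assume r: "r \<in> S"
    have mono: "((\<lambda>r. ((r - t) ^ Suc j / fact (Suc j)) *\<^sub>R w (Suc j) t) has_vector_derivative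
        ((r - t) ^ j / fact j) *\<^sub>R w (Suc j) t) (at r within S)" for j
    proof -
      have nz: "1 + real j \<noteq> 0"
        by linarith
      have "((\<lambda>r. (r - t) ^ Suc j / fact (Suc j)) has_vector_derivative
          (r - t) ^ j / fact j) (at r within S)"
        unfolding has_real_derivative_iff_has_vector_derivative[symmetric]
        by (rule DERIV_cong[OF DERIV_cdivide[OF DERIV_power_Suc[where D = 1]]])
          (use nz in \<open>auto intro!: derivative_eq_intros simp: nonzero_divide_eq_eq\<close>)
      then show ?thesis
        by (rule has_vector_derivative_scaleR[where g = "\<lambda>_. w (Suc j) t" and g' = 0,
              simplified has_real_derivative_iff_has_vector_derivative, THEN has_vector_derivative_eq_rhs])
          auto
    qed
    have "(w 0 has_vector_derivative w 1 r) (at r within S)"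
      using Suc.prems(2)[of 0 r] r by simp
    then have "((\<lambda>r. w 0 r - (w 0 t + (\<Sum>j<n. ((r - t) ^ Suc j / fact (Suc j)) *\<^sub>R w (Suc j) t)))
        has_vector_derivative w 1 r - (0 + (\<Sum>j<n. ((r - t) ^ j / fact j) *\<^sub>R w (Suc j) t)))
        (at r within S)"
      by (intro has_vector_derivative_diff has_vector_derivative_add has_vector_derivative_sum
          has_vector_derivative_const mono)
    then show "(f has_vector_derivative f' r) (at r within S)"
      by (simp add: f_alt[abs_def] f'_def)
    show "norm (f' r) \<le> K * \<bar>r - t\<bar> ^ n"
      using Suc.IH[of r "\<lambda>j. w (Suc j)"] r Suc.prems(2,3) by (simp add: f'_def)
  next
    show "f t = 0"
      by (simp add: f_alt)
    show "0 \<le> K"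
      using Suc.prems(3)[OF S(2)] norm_ge_zero order_trans by blast
  qed
  then show ?case
    by (simp add: f_def)
qed

section \<open>Linearity of the Laplacian\<close>

lemma partial_cong_open:
  assumes "open D" "x \<in> D" "\<And>y. y \<in> D \<Longrightarrow> f y = g y"
  shows "partial b f x = partial b g x"
proof -
  have "((\<lambda>s::real. x + s *\<^sub>R b) \<longlongrightarrow> x + 0 *\<^sub>R b) (nhds 0)"
    by (intro tendsto_intros filterlim_ident)
  then have "\<forall>\<^sub>F s::real in nhds 0. x + s *\<^sub>R b \<in> D"
    using topological_tendstoD assms(1,2) by fastforce
  then have "\<forall>\<^sub>F s::real in nhds 0. f (x + s *\<^sub>R b) = g (x + s *\<^sub>R b)"
    by eventually_elim (simp add: assms(3))
  then show ?thesis
    unfolding partial_def by (intro vector_derivative_cong_eq) auto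
qed

lemma partial_leapfrog_sum:
  assumes "(\<lambda>s::real. f (x + s *\<^sub>R b)) differentiable (at 0)"
    and "(\<lambda>s::real. g (x + s *\<^sub>R b)) differentiable (at 0)"
    and "(\<lambda>s::real. h (x + s *\<^sub>R b)) differentiable (at 0)"
  shows "partial b (\<lambda>y. f y + 2 * g y + h y) x
    = partial b f x + 2 * partial b g x + partial b h x"
  unfolding partial_def
  using assms unfolding vector_derivative_works
  by (intro vector_derivative_at has_vector_derivative_add has_vector_derivative_mult_right)

text \<open>
  The sum rule for the first derivative holds only on \<open>D\<close>, so the second derivative has to be
  taken of functions that agree merely there; openness of \<open>D\<close> makes this enough.
\<close>

lemma laplacian_leapfrog_sum:
  fixes f g h :: "'a::euclidean_space \<Rightarrow> complex"
  assumes D: "open D" "x \<in> D" and "Ck_on 2 D f" "Ck_on 2 D g" "Ck_on 2 D h"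
  shows "laplacian (\<lambda>y. f y + 2 * g y + h y) x = laplacian f x + 2 * laplacian g x + laplacian h x"
proof -
  have C1: "(\<lambda>s::real. k (y + s *\<^sub>R b)) differentiable (at 0)"
    and C2: "(\<lambda>s::real. partial b k (y + s *\<^sub>R b)) differentiable (at 0)"
    if "Ck_on 2 D k" "y \<in> D" "b \<in> Basis" for k :: "'a \<Rightarrow> complex" and y b
    using that by (auto simp: numeral_2_eq_2)
  have "partial b (partial b (\<lambda>y. f y + 2 * g y + h y)) x
      = partial b (partial b f) x + 2 * partial b (partial b g) x + partial b (partial b h) x"
    if b: "b \<in> Basis" for b
  proof -
    have "partial b (partial b (\<lambda>y. f y + 2 * g y + h y)) x
        = partial b (\<lambda>y. partial b f y + 2 * partial b g y + partial b h y) x"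
      by (rule partial_cong_open[OF D]) (intro partial_leapfrog_sum C1 assms b)
    also have "\<dots> = partial b (partial b f) x + 2 * partial b (partial b g) x
        + partial b (partial b h) x"
      by (intro partial_leapfrog_sum C2 assms b)
    finally show ?thesis .
  qed
  then show ?thesis
    by (simp add: laplacian_def sum.distrib sum_distrib_left)
qed

section \<open>The equation at the end points of the time interval\<close>

lemma NLS_at_closed_interval:
  fixes v v' L :: "real \<Rightarrow> complex"
  assumes T: "0 < T"
    and v: "continuous_on {0..T} v" and v': "continuous_on {0..T} v'"
    and L: "continuous_on {0..T} L"
    and eq: "\<And>t. t \<in> {0<..<T} \<Longrightarrow>
      \<i> * v' t + L t - of_real lam * of_real ((cmod (v t))\<^sup>2) * v t = 0"
    and t: "t \<in> {0..T}"
  shows "\<i> * v' t + L t - of_real lam * of_real ((cmod (v t))\<^sup>2) * v t = 0"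
proof (rule continuous_constant_on_closure[where S = "{0<..<T}" and f =
      "\<lambda>t. \<i> * v' t + L t - of_real lam * of_real ((cmod (v t))\<^sup>2) * v t"])
  show "continuous_on (closure {0<..<T})
      (\<lambda>t. \<i> * v' t + L t - of_real lam * of_real ((cmod (v t))\<^sup>2) * v t)"
    using T by (auto intro!: continuous_intros v v' L)
  show "t \<in> closure {0<..<T}"
    using T t by simp
qed (rule eq)

section \<open>Consistency of the cubic term and of the time difference\<close>

text \<open>
  With \<open>a = b + d\<close>, \<open>c = b + e\<close> and \<open>s = d + e\<close>, both cubic expressions start with
  \<open>|b|\<^sup>2b + (|b|\<^sup>2s + 2 Re(b cnj s) b) / 4\<close>, so their difference consists of terms of degree
  at least two in \<open>d\<close> and \<open>e\<close>. Two of these factors are estimated by \<open>\<delta>\<close>, and a third one, if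
  present, by a multiple of \<open>M\<close>, so that the bound is homogeneous of degree two in \<open>\<delta>\<close>.
\<close>

lemma cubic_average_defect:
  fixes a b c d e :: complex
  defines "d \<equiv> a - b" and "e \<equiv> c - b"
  assumes b: "cmod b \<le> M" and d: "cmod d \<le> \<delta>" "cmod d \<le> 2 * M"
    and e: "cmod e \<le> \<delta>" "cmod e \<le> 2 * M"
  shows "cmod ((of_real ((cmod a)\<^sup>2) * a + 2 * (of_real ((cmod b)\<^sup>2) * b) + of_real ((cmod c)\<^sup>2) * c) / 4
    - (of_real ((cmod ((b + c) / 2))\<^sup>2) + of_real ((cmod ((a + b) / 2))\<^sup>2)) * (a + 2 * b + c) / 8)
    \<le> 7 / 2 * M * \<delta>\<^sup>2" (is "cmod ?E \<le> _")
proof -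
  \<comment> \<open>\<open>P z\<close> is what \<open>|b + z|\<^sup>2(b + z)\<close> contains beyond first order in \<open>z\<close>; \<open>Q1\<close> and \<open>Q2\<close>
    come from the expansion
    \<open>|b + d/2|\<^sup>2 + |b + e/2|\<^sup>2 = 2|b|\<^sup>2 + Re(b cnj s) + (|d|\<^sup>2 + |e|\<^sup>2) / 4\<close>,
    multiplied by \<open>4b + s\<close>.\<close>
  define s where "s = d + e"
  define P where "P z = z * cnj z * b + (b * cnj z + cnj b * z) * z + z * cnj z * z" for z
  define Q1 where "Q1 = (b * cnj s + cnj b * s) * s"
  define Q2 where "Q2 = (d * cnj d + e * cnj e) * (4 * b + s)"
  have ac: "a = b + d" "c = b + e"
    by (simp_all add: d_def e_def)
  have E: "?E = (P d + P e) / 4 - Q1 / 16 - Q2 / 32"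
    unfolding complex_norm_square ac P_def Q1_def Q2_def s_def
    by (simp add: field_simps)
  have M: "0 \<le> M" and \<delta>: "0 \<le> \<delta>"
    using b d norm_ge_zero order_trans by blast+
  have P: "cmod (P z) \<le> 5 * M * \<delta>\<^sup>2" if z: "cmod z \<le> \<delta>" "cmod z \<le> 2 * M" for z
  proof -
    have "cmod (P z) \<le> cmod z * cmod z * cmod b + (cmod b * cmod z + cmod b * cmod z) * cmod z
        + cmod z * cmod z * cmod z"
      unfolding P_def
      by (intro norm_triangle_mono norm_mult_ineq[THEN order_trans] mult_mono)
        (auto simp: norm_mult)
    also have "\<dots> \<le> \<delta> * \<delta> * M + (M * \<delta> + M * \<delta>) * \<delta> + \<delta> * \<delta> * (2 * M)"
      using z b M \<delta> by (intro add_mono mult_mono) auto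
    finally show ?thesis
      by (simp add: power2_eq_square algebra_simps)
  qed
  have s: "cmod s \<le> 2 * \<delta>" "cmod s \<le> 4 * M"
    using norm_triangle_ineq[of d e] d e unfolding s_def by linarith+
  have Q1: "cmod Q1 \<le> 8 * M * \<delta>\<^sup>2"
  proof -
    have "cmod Q1 \<le> (cmod b * cmod s + cmod b * cmod s) * cmod s"
      unfolding Q1_def norm_mult
      by (intro mult_mono norm_triangle_mono) (auto simp: norm_mult)
    also have "\<dots> \<le> (M * (2 * \<delta>) + M * (2 * \<delta>)) * (2 * \<delta>)"
      using s b M \<delta> by (intro add_mono mult_mono) auto
    finally show ?thesis
      by (simp add: power2_eq_square algebra_simps)
  qed
  have Q2: "cmod Q2 \<le> 16 * M * \<delta>\<^sup>2"
  proof -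
    have "cmod Q2 \<le> (cmod d * cmod d + cmod e * cmod e) * (4 * cmod b + cmod s)"
      unfolding Q2_def norm_mult
      by (intro mult_mono norm_triangle_mono) (auto simp: norm_mult)
    also have "\<dots> \<le> (\<delta> * \<delta> + \<delta> * \<delta>) * (4 * M + 4 * M)"
      using s b d e M \<delta> by (intro add_mono mult_mono) auto
    finally show ?thesis
      by (simp add: power2_eq_square algebra_simps)
  qed
  have "cmod ?E \<le> (cmod (P d) + cmod (P e)) / 4 + cmod Q1 / 16 + cmod Q2 / 32"
    unfolding E by (intro order_trans[OF norm_triangle_ineq4] add_mono)
      (auto simp: norm_divide intro!: divide_right_mono norm_triangle_ineq)
  also have "\<dots> \<le> 7 / 2 * M * \<delta>\<^sup>2"
    using P[OF d] P[OF e] Q1 Q2 by (simp add: field_simps)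
  finally show ?thesis .
qed

text \<open>
  The remainder \<open>A\<close> of \<open>w 0\<close> has order 3 and the remainder \<open>B\<close> of \<open>w 1\<close> order 2. The even
  Taylor terms drop out of the difference quotient and the odd ones out of the average, and what
  is left of either is \<open>w 1 t\<close>. The quotient contributes \<open>M \<tau>\<^sup>2\<close> to the bound, the average
  \<open>M \<tau>\<^sup>2 / 2\<close>.
\<close>

lemma leapfrog_linear_defect:
  fixes w :: "nat \<Rightarrow> real \<Rightarrow> complex"
  assumes S: "convex S" "t \<in> S" "t + \<tau> \<in> S" "t - \<tau> \<in> S" and \<tau>: "0 < \<tau>"
    and dw: "\<And>j r. j < 3 \<Longrightarrow> r \<in> S \<Longrightarrow>
               (w j has_vector_derivative w (Suc j) r) (at r within S)"
    and bd: "\<And>r. r \<in> S \<Longrightarrow> cmod (w 3 r) \<le> M"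
  shows "cmod ((w 0 (t + \<tau>) - w 0 (t - \<tau>)) / (2 * of_real \<tau>)
      - (w 1 (t + \<tau>) + 2 * w 1 t + w 1 (t - \<tau>)) / 4) \<le> 3 / 2 * M * \<tau>\<^sup>2"
proof -
  define A where "A s = w 0 (t + s) - (w 0 t + s *\<^sub>R w 1 t + (s\<^sup>2 / 2) *\<^sub>R w 2 t)" for s
  define B where "B s = w 1 (t + s) - (w 1 t + s *\<^sub>R w 2 t)" for s
  have A: "cmod (A s) \<le> M * \<bar>s\<bar> ^ 3" if "t + s \<in> S" for s
    using Taylor_remainder_bound[OF S(1,2) that, of 3 w, OF dw bd]
    by (simp add: A_def eval_nat_numeral)
  have B: "cmod (B s) \<le> M * \<bar>s\<bar> ^ 2" if "t + s \<in> S" for s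
    using Taylor_remainder_bound[OF S(1,2) that, of 2 "\<lambda>j. w (Suc j)" M] dw bd
    by (simp add: B_def eval_nat_numeral)
  have "(w 0 (t + \<tau>) - w 0 (t - \<tau>)) / (2 * of_real \<tau>)
      - (w 1 (t + \<tau>) + 2 * w 1 t + w 1 (t - \<tau>)) / 4
      = (A \<tau> - A (- \<tau>)) / (2 * of_real \<tau>) - (B \<tau> + B (- \<tau>)) / 4"
    using \<tau> by (simp add: A_def B_def scaleR_conv_of_real field_simps)
  also have "cmod \<dots> \<le> (cmod (A \<tau>) + cmod (A (- \<tau>))) / (2 * \<tau>) + (cmod (B \<tau>) + cmod (B (- \<tau>))) / 4"
    using \<tau> by (intro norm_triangle_le_diff add_mono)
      (auto simp: norm_divide norm_mult intro!: divide_right_mono norm_triangle_ineq norm_triangle_ineq4)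
  also have "\<dots> \<le> (M * \<tau> ^ 3 + M * \<tau> ^ 3) / (2 * \<tau>) + (M * \<tau>\<^sup>2 + M * \<tau>\<^sup>2) / 4"
    using A[of \<tau>] A[of "- \<tau>"] B[of \<tau>] B[of "- \<tau>"] S \<tau>
    by (intro add_mono divide_right_mono) auto
  also have "\<dots> = 3 / 2 * M * \<tau>\<^sup>2"
    using \<tau> by (simp add: field_simps eval_nat_numeral)
  finally show ?thesis .
qed

section \<open>The truncation error\<close>

theorem lemma3p2:
  fixes D :: "(real ^ 'd) set"
    and T lam :: real
    and u :: "real \<Rightarrow> real ^ 'd \<Rightarrow> complex"
  assumes "CARD('d) \<in> {1, 2, 3}"
    and "open D" and "connected D" and "D \<noteq> {}" and "bounded D"
    and "T > 0"
    and "lam = 1 \<or> lam = -1"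
    and "NLS_solution T D lam u"
    and "time_Ck_bounded 3 T D u"
  shows "\<exists>C. \<forall>\<tau>>0. \<forall>n\<ge>1. real (n + 1) * \<tau> \<le> T \<longrightarrow>
           (\<forall>x\<in>D. cmod (TE lam \<tau> u n x) \<le> C * \<tau>\<^sup>2)"
proof -
  obtain w :: "nat \<Rightarrow> real \<Rightarrow> real ^ 'd \<Rightarrow> complex" where w0: "w 0 = u"
    and dw: "\<And>j x t. j < 3 \<Longrightarrow> x \<in> D \<Longrightarrow> t \<in> {0..T} \<Longrightarrow>
      ((\<lambda>s. w j s x) has_vector_derivative w (Suc j) t x) (at t within {0..T})"
    and cw: "\<And>j x. j \<le> 3 \<Longrightarrow> x \<in> D \<Longrightarrow> continuous_on {0..T} (\<lambda>t. w j t x)"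
    and bw: "\<And>j. j \<le> 3 \<Longrightarrow> bounded ((\<lambda>(t, x). w j t x) ` ({0..T} \<times> D))"
    using assms(9) unfolding time_Ck_bounded_def by blast
  have "bounded (\<Union>j\<le>3::nat. (\<lambda>(t, x). w j t x) ` ({0..T} \<times> D))"
    using bw by (intro bounded_UN) auto
  then obtain M where M: "\<And>j t x. j \<le> 3 \<Longrightarrow> t \<in> {0..T} \<Longrightarrow> x \<in> D \<Longrightarrow> cmod (w j t x) \<le> M"
    unfolding bounded_iff by fastforce
  have C2: "\<And>t. t \<in> {0..T} \<Longrightarrow> Ck_on 2 D (u t)"
    and cL: "\<And>x. x \<in> D \<Longrightarrow> continuous_on {0..T} (\<lambda>t. laplacian (u t) x)"
    and nls: "\<And>t x. t \<in> {0<..<T} \<Longrightarrow> x \<in> D \<Longrightarrow>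
        \<i> * vector_derivative (\<lambda>s. u s x) (at t) + laplacian (u t) x
          - of_real lam * of_real ((cmod (u t x))\<^sup>2) * u t x = 0"
    using assms(8) unfolding NLS_solution_def by auto
  have lap: "laplacian (u t) x = of_real lam * (of_real ((cmod (u t x))\<^sup>2) * u t x) - \<i> * w 1 t x"
    if x: "x \<in> D" and t: "t \<in> {0..T}" for x t
  proof -
    have "\<i> * w 1 t x + laplacian (u t) x - of_real lam * of_real ((cmod (u t x))\<^sup>2) * u t x = 0"
    proof (rule NLS_at_closed_interval[OF \<open>T > 0\<close> _ _ cL[OF x] _ t])
      fix r assume r: "r \<in> {0<..<T}"
      have "((\<lambda>s. u s x) has_vector_derivative w 1 r x) (at r)"
        using dw[of 0 x r] r x at_within_Icc_at[of 0 r T] by (simp add: w0)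
      then show "\<i> * w 1 r x + laplacian (u r) x
          - of_real lam * of_real ((cmod (u r x))\<^sup>2) * u r x = 0"
        using nls[OF r x] by (simp add: vector_derivative_at)
    qed (use cw[of 0 x] cw[of 1 x] x w0 in auto)
    then show ?thesis
      by (simp add: algebra_simps)
  qed
  show ?thesis
  proof (intro exI[of _ "3 / 2 * M + 7 / 2 * M * M\<^sup>2"] allI impI ballI)
    fix \<tau> :: real and n :: nat and x
    assume \<tau>: "\<tau> > 0" and n: "n \<ge> 1" and le: "real (n + 1) * \<tau> \<le> T" and x: "x \<in> D"
    define t where "t = real n * \<tau>"
    have tp: "real (n + 1) * \<tau> = t + \<tau>" and tm: "real (n - 1) * \<tau> = t - \<tau>"
      using n by (auto simp: t_def algebra_simps of_nat_diff)
    have "0 \<le> real (n - 1) * \<tau>"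
      using \<tau> by simp
    then have S: "t \<in> {0..T}" "t + \<tau> \<in> {0..T}" "t - \<tau> \<in> {0..T}"
      using le \<tau> unfolding tp tm by auto
    let ?a = "u (t + \<tau>) x" and ?b = "u t x" and ?c = "u (t - \<tau>) x"
    define lin where "lin = (?a - ?c) / (2 * of_real \<tau>)
        - (w 1 (t + \<tau>) x + 2 * w 1 t x + w 1 (t - \<tau>) x) / 4"
    define cub where "cub = (of_real ((cmod ?a)\<^sup>2) * ?a + 2 * (of_real ((cmod ?b)\<^sup>2) * ?b)
          + of_real ((cmod ?c)\<^sup>2) * ?c) / 4
        - (of_real ((cmod ((?b + ?c) / 2))\<^sup>2) + of_real ((cmod ((?a + ?b) / 2))\<^sup>2))
          * (?a + 2 * ?b + ?c) / 8"
    have sum: "laplacian (\<lambda>y. u (t + \<tau>) y + 2 * u t y + u (t - \<tau>) y) x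
        = laplacian (u (t + \<tau>)) x + 2 * laplacian (u t) x + laplacian (u (t - \<tau>)) x"
      using laplacian_leapfrog_sum[OF \<open>open D\<close> x] C2 S by blast
    have TE: "TE lam \<tau> u n x = \<i> * lin + of_real lam * cub"
      unfolding TE_def leapfrog_residual_def tp tm t_def[symmetric] sum lin_def cub_def
        lap[OF x S(1)] lap[OF x S(2)] lap[OF x S(3)]
      using \<tau> by (simp add: field_simps)
    have lin: "cmod lin \<le> 3 / 2 * M * \<tau>\<^sup>2"
      using leapfrog_linear_defect[of "{0..T}" t \<tau> "\<lambda>j s. w j s x" M] S \<tau> dw x M
      unfolding lin_def w0[symmetric] by auto
    \<comment> \<open>The second bound, free of \<open>\<tau>\<close>, keeps the constant independent of \<open>T\<close>: it absorbs the
      third powers of the increments.\<close>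
    have near: "cmod (u r x - ?b) \<le> M * \<tau>" "cmod (u r x - ?b) \<le> 2 * M"
      if "r \<in> {0..T}" "\<bar>r - t\<bar> = \<tau>" for r
    proof -
      show "cmod (u r x - ?b) \<le> M * \<tau>"
        using Taylor_remainder_bound[of "{0..T}" t r 1 "\<lambda>j s. w j s x" M] S(1) that dw[of 0 x] x M
        by (simp add: w0)
      show "cmod (u r x - ?b) \<le> 2 * M"
        using norm_triangle_ineq4[of "u r x" ?b] M[of 0 r x] M[of 0 t x] S(1) that(1) x
        by (simp add: w0)
    qed
    have cub: "cmod cub \<le> 7 / 2 * M * (M * \<tau>)\<^sup>2"
      unfolding cub_def
      by (rule cubic_average_defect) (use near S \<tau> M[of 0 t x] x w0 in auto)
    have "cmod (TE lam \<tau> u n x) \<le> cmod lin + cmod cub"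
      unfolding TE using norm_triangle_ineq[of "\<i> * lin" "of_real lam * cub"] assms(7)
      by (auto simp: norm_mult)
    also have "\<dots> \<le> (3 / 2 * M + 7 / 2 * M * M\<^sup>2) * \<tau>\<^sup>2"
      using lin cub by (simp add: algebra_simps power_mult_distrib)
    finally show "cmod (TE lam \<tau> u n x) \<le> (3 / 2 * M + 7 / 2 * M * M\<^sup>2) * \<tau>\<^sup>2" .
  qed
qed

end
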